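(* Let $0<\alpha<1$, $\gamma\ge 0$ and let $\kappa$ be a constant. Then the function $$f(t)=\operatorname{E}_{\alpha,1+\gamma/\alpha,\gamma/\alpha}\left(-\kappa t^{\alpha+\gamma}\right),\qquad t>0,$$ is an eigenfunction of the operator $\mathcal{D}^{(\alpha,\gamma)}_t$ with eigenvalue $-\kappa$, i.e. $$\mathcal{D}^{(\alpha,\gamma)}_t f(t)=-\kappa f(t),\qquad t>0 .$$
   Context: For $0<\alpha<1$, $\gamma\ge0$ the stretched Caputo-type operator is $\mathcal{D}^{(\alpha,\gamma)}_t f(t)=\frac{t^{-\gamma}}{\Gamma(1-\alpha)}\int_0^t\frac{f'(s)}{(t-s)^{\alpha}}\,ds$. Kilbas-Saigo function: for $a,m>0$, $l>-1/a$, $\operatorname{E}_{a,m,l}(z)=\sum_{n=0}^\infty c_n z^n$ with $c_0=1$ and $c_n=\prod_{k=0}^{n-1}\frac{\Gamma[1+a(km+l)]}{\Gamma[1+a(km+l+1)]}$. The constant $\kappa$ may be real or complex. *)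

theory Defs
  imports "HOL-Analysis.Analysis"
begin

text \<open>Scalars range over a complete, second countable real normed field, so that real and complex
  values are covered simultaneously.\<close>

definition kilbas_saigo_coeff :: "real \<Rightarrow> real \<Rightarrow> real \<Rightarrow> nat \<Rightarrow> real" where
  "kilbas_saigo_coeff a m l n =
     (\<Prod>k<n. Gamma (1 + a * (real k * m + l)) / Gamma (1 + a * (real k * m + l + 1)))"

definition kilbas_saigo ::
  "real \<Rightarrow> real \<Rightarrow> real \<Rightarrow> 'a :: {real_normed_field, banach} \<Rightarrow> 'a" where
  "kilbas_saigo a m l z = (\<Sum>n. of_real (kilbas_saigo_coeff a m l n) * z ^ n)"

definition stretched_caputo_integrand ::
  "real \<Rightarrow> (real \<Rightarrow> 'a) \<Rightarrow> real \<Rightarrow> real \<Rightarrow> 'a :: {real_normed_field, banach, second_countable_topology}" where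
  "stretched_caputo_integrand \<alpha> f t s = vector_derivative f (at s) /\<^sub>R (t - s) powr \<alpha>"

definition stretched_caputo ::
  "real \<Rightarrow> real \<Rightarrow> (real \<Rightarrow> 'a) \<Rightarrow> real \<Rightarrow> 'a :: {real_normed_field, banach, second_countable_topology}" where
  "stretched_caputo \<alpha> \<gamma> f t =
     (t powr (- \<gamma>) / Gamma (1 - \<alpha>)) *\<^sub>R
       (LINT s:{0<..<t}|lborel. stretched_caputo_integrand \<alpha> f t s)"

text \<open>Both the derivative and the Lebesgue integral have junk values when they do not exist;
  the following predicate says that the expression above is meaningful at \<open>t\<close>. Only points
  of the open interval matter, as \<open>f'\<close> may be unbounded near 0.\<close>

definition stretched_caputo_defined ::
  "real \<Rightarrow> (real \<Rightarrow> 'a :: {real_normed_field, banach, second_countable_topology}) \<Rightarrow> real \<Rightarrow> bool" where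
  "stretched_caputo_defined \<alpha> f t \<longleftrightarrow>
     (\<forall>s\<in>{0<..<t}. f differentiable (at s)) \<and>
     set_integrable lborel {0<..<t} (stretched_caputo_integrand \<alpha> f t)"

definition stretched_caputo_eigenfunction ::
  "real \<Rightarrow> real \<Rightarrow> 'a \<Rightarrow> (real \<Rightarrow> 'a :: {real_normed_field, banach, second_countable_topology}) \<Rightarrow> bool" where
  "stretched_caputo_eigenfunction \<alpha> \<gamma> c f \<longleftrightarrow>
     (\<exists>t>0. f t \<noteq> 0) \<and>
     (\<forall>t>0. stretched_caputo_defined \<alpha> f t \<and> stretched_caputo \<alpha> \<gamma> f t = c * f t)"

end

(* Write b = alpha + gamma. Termwise, the operator sends t^((n+1)b) to a multiple of t^(nb), by the
   Beta integral, and the Kilbas-Saigo coefficients are exactly those for which this multiple turns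
   c_(n+1) into c_n; hence it shifts the series and produces the factor -kappa. Log-convexity of
   Gamma gives Gamma(x)/Gamma(x+a) -> 0, so the series is entire; the resulting absolute summability
   lets one interchange sum and integral. *)
theory Submission
  imports Defs "HOL-Real_Asymp.Real_Asymp"
begin

section \<open>Decay of quotients of Gamma values\<close>

lemma Gamma_ratio_le:
  fixes a x :: real
  assumes "0 < a" "a < 1" "0 < x"
  shows "Gamma x / Gamma (x + a) \<le> (x + a) powr (1 - a) / x"
proof -
  have G: "Gamma x > 0" "Gamma (x + a) > 0" "Gamma (x + 1) > 0" "Gamma (x + a + 1) > 0"
    using assms by (auto intro!: Gamma_real_pos)
  have rec: "Gamma (x + 1) = x * Gamma x" "Gamma (x + a + 1) = (x + a) * Gamma (x + a)"
    using assms by (auto intro!: Gamma_plus1 elim!: nonpos_Ints_cases)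
  \<comment> \<open>The point x + 1 is the convex combination of x + a and x + a + 1 with weights a
    and 1 - a, so log-convexity bounds \<open>Gamma (x + 1)\<close>; the functional equation then
    leads back to \<open>Gamma x\<close> and \<open>Gamma (x + a)\<close>.\<close>
  have "(ln \<circ> Gamma) ((1 - (1 - a)) *\<^sub>R (x + a) + (1 - a) *\<^sub>R (x + a + 1))
      \<le> (1 - (1 - a)) * (ln \<circ> Gamma) (x + a) + (1 - a) * (ln \<circ> Gamma) (x + a + 1)"
    using assms by (intro convex_onD[OF log_convex_Gamma_real]) auto
  moreover have "(1 - (1 - a)) *\<^sub>R (x + a) + (1 - a) *\<^sub>R (x + a + 1) = x + 1"
    by (simp add: algebra_simps)
  ultimately have "ln (Gamma (x + 1)) \<le> a * ln (Gamma (x + a)) + (1 - a) * ln (Gamma (x + a + 1))"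
    by simp
  also have "\<dots> = ln (Gamma (x + a)) + (1 - a) * ln (x + a)"
  proof -
    have "ln (Gamma (x + a + 1)) = ln (x + a) + ln (Gamma (x + a))"
      unfolding rec(2) by (rule ln_mult_pos) (use assms G(2) in linarith)+
    then show ?thesis
      by (simp only:) (simp add: left_diff_distrib distrib_left)
  qed
  also have "\<dots> = ln (Gamma (x + a) * (x + a) powr (1 - a))"
    using assms G(2) by (subst ln_mult_pos) (simp_all add: ln_powr)
  finally have "Gamma (x + 1) \<le> Gamma (x + a) * (x + a) powr (1 - a)"
    using assms G by (subst (asm) ln_le_cancel_iff) auto
  then show ?thesis
    unfolding rec(1) using assms G(2) by (simp add: field_simps)
qed

text \<open>The preceding bound is of order \<open>x powr (- a)\<close>, which squeezes the
  nonnegative quotient to 0.\<close>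

lemma Gamma_ratio_tendsto_0:
  fixes a :: real
  assumes "0 < a" "a < 1"
  shows "((\<lambda>x. Gamma x / Gamma (x + a)) \<longlongrightarrow> 0) at_top"
proof (rule tendsto_sandwich[where f = "\<lambda>_. 0" and h = "\<lambda>x. (x + a) powr (1 - a) / x"])
  show "((\<lambda>x. (x + a) powr (1 - a) / x) \<longlongrightarrow> 0) at_top"
    using assms by real_asymp
  show "\<forall>\<^sub>F x in at_top. Gamma x / Gamma (x + a) \<le> (x + a) powr (1 - a) / x"
    using eventually_gt_at_top[of 0] by eventually_elim (rule Gamma_ratio_le[OF assms])
  show "\<forall>\<^sub>F x in at_top. 0 \<le> Gamma x / Gamma (x + a)"
    using eventually_gt_at_top[of 0]
    by eventually_elim (intro divide_nonneg_nonneg Gamma_real_nonneg; use assms in simp)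
qed simp

section \<open>Convergence and differentiation of the Kilbas-Saigo series\<close>

lemma kilbas_saigo_coeff_Suc:
  "kilbas_saigo_coeff a m l (Suc n) = kilbas_saigo_coeff a m l n *
     (Gamma (1 + a * (real n * m + l)) / Gamma (1 + a * (real n * m + l + 1)))"
  by (simp add: kilbas_saigo_coeff_def)

text \<open>Ratio test: the recursion factor is \<open>Gamma x / Gamma (x + a)\<close> with x
  tending to infinity because a * m > 0, so for every z the norms of the terms are eventually at
  least halved at each step.\<close>

lemma summable_kilbas_saigo:
  fixes z :: "'a :: {real_normed_field, banach}"
  assumes "0 < a" "a < 1" "0 < m"
  shows "summable (\<lambda>n. of_real (kilbas_saigo_coeff a m l n) * z ^ n)"
proof -
  define r where "r n = Gamma (1 + a * (real n * m + l)) / Gamma (1 + a * (real n * m + l + 1))" for n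
  have "filterlim (\<lambda>n. 1 + a * (real n * m + l)) at_top sequentially"
    using assms by real_asymp
  from filterlim_compose[OF Gamma_ratio_tendsto_0[OF assms(1,2)] this]
  have "r \<longlonglongrightarrow> 0"
    unfolding r_def by (simp add: algebra_simps)
  then have "(\<lambda>n. norm (r n) * norm z) \<longlonglongrightarrow> 0"
    by (intro tendsto_mult_left_zero tendsto_norm_zero)
  then have "\<forall>\<^sub>F n in sequentially. norm (r n) * norm z < 1 / 2"
    by (rule order_tendstoD) simp
  then obtain N where N: "\<And>n. n \<ge> N \<Longrightarrow> norm (r n) * norm z < 1 / 2"
    unfolding eventually_sequentially by blast
  show ?thesis
  proof (rule summable_ratio_test[where c = "1/2"])
    fix n assume "n \<ge> N"
    from less_imp_le[OF N[OF this]]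
    have "norm (r n) * norm z * (norm (kilbas_saigo_coeff a m l n) * norm z ^ n)
        \<le> 1 / 2 * (norm (kilbas_saigo_coeff a m l n) * norm z ^ n)"
      by (rule mult_right_mono) simp
    then show "norm (of_real (kilbas_saigo_coeff a m l (Suc n)) * z ^ Suc n)
        \<le> 1 / 2 * norm (of_real (kilbas_saigo_coeff a m l n) * z ^ n)"
      by (simp only: kilbas_saigo_coeff_Suc flip: r_def)
        (simp add: norm_mult norm_power abs_mult mult_ac)
  qed simp
qed

lemma kilbas_saigo_has_field_derivative:
  fixes z :: "'a :: {real_normed_field, banach}"
  assumes "0 < a" "a < 1" "0 < m"
  shows "(kilbas_saigo a m l has_field_derivative
           (\<Sum>n. diffs (\<lambda>n. of_real (kilbas_saigo_coeff a m l n)) n * z ^ n)) (at z)"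
  unfolding kilbas_saigo_def
  by (rule termdiffs_strong_converges_everywhere) (rule summable_kilbas_saigo[OF assms])

lemma summable_diffs_kilbas_saigo:
  fixes z :: "'a :: {real_normed_field, banach}"
  assumes "0 < a" "a < 1" "0 < m"
  shows "summable (\<lambda>n. diffs (\<lambda>n. of_real (kilbas_saigo_coeff a m l n)) n * z ^ n)"
  by (rule termdiff_converges_all) (rule summable_kilbas_saigo[OF assms])

section \<open>The Euler Beta integral on an interval of length t\<close>

lemma has_bochner_integral_Beta_scaled:
  fixes a b t :: real
  assumes "0 < a" "0 < b" "0 < t"
  shows "has_bochner_integral lborel
           (\<lambda>s. indicator {0<..<t} s *\<^sub>R (s powr (a - 1) * (t - s) powr (b - 1)))
           (t powr (a + b - 1) * Beta a b)"
proof -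
  define g where "g u = indicator {0<..<1} u *\<^sub>R (u powr (a - 1) * (1 - u) powr (b - 1))" for u :: real
  have int: "set_integrable lborel {0<..<1} (\<lambda>u. u powr (a - 1) * (1 - u) powr (b - 1))"
    by (rule set_integrable_subset[OF integrable_Beta]) (use assms in auto)
  \<comment> \<open>Only the two endpoints are dropped; the gauge integral supplies the value of the
    Lebesgue integral whose existence is \<open>int\<close>.\<close>
  have "((\<lambda>u. u powr (a - 1) * (1 - u) powr (b - 1)) has_integral Beta a b) {0<..<1}"
    using has_integral_Beta_real[of a b] assms by (simp add: has_integral_Icc_iff_Ioo)
  then have val: "integral\<^sup>L lborel g = Beta a b"
    using set_borel_integral_eq_integral(2)[OF int]
    unfolding set_lebesgue_integral_def g_def by (simp add: integral_unique)
  have g: "integrable lborel g"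
    using int unfolding set_integrable_def g_def .
  \<comment> \<open>Substitution u = s / t, with Jacobian factor t.\<close>
  have "has_bochner_integral lborel (\<lambda>s. g (0 + (1 / t) * s)) (t * Beta a b)"
    using lborel_integrable_real_affine[OF g, of "1 / t" 0]
      lborel_integral_real_affine[of "1 / t" g 0] assms val
    by (simp add: has_bochner_integral_iff field_simps)
  \<comment> \<open>The factor \<open>t powr (a + b - 2)\<close> clears the denominators of u = s /
    t and 1 - u = (t - s) / t.\<close>
  then have "has_bochner_integral lborel (\<lambda>s. t powr (a + b - 2) * g (0 + (1 / t) * s))
      (t powr (a + b - 2) * (t * Beta a b))"
    by (rule has_bochner_integral_mult_right)
  also have "(\<lambda>s. t powr (a + b - 2) * g (0 + (1 / t) * s)) =
      (\<lambda>s. indicator {0<..<t} s *\<^sub>R (s powr (a - 1) * (t - s) powr (b - 1)))"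
  proof
    fix s
    show "t powr (a + b - 2) * g (0 + (1 / t) * s) =
      indicator {0<..<t} s *\<^sub>R (s powr (a - 1) * (t - s) powr (b - 1))"
    proof (cases "s \<in> {0<..<t}")
      case True
      have "1 - s / t = (t - s) / t"
        using assms by (simp add: field_simps)
      moreover have "t powr (a + b - 2) = t powr (a - 1) * t powr (b - 1)"
        by (simp flip: powr_add)
      ultimately show ?thesis
        using True assms by (simp add: g_def powr_divide)
    next
      case False
      then show ?thesis
        using assms by (auto simp: g_def indicator_def field_simps)
    qed
  qed
  also have "t powr (a + b - 2) * (t * Beta a b) = t powr (a + b - 1) * Beta a b"
    using assms powr_add[of t "a + b - 2" 1] by simp
  finally show ?thesis .
qed

section \<open>Value at 0, and identities and signs of the coefficients\<close>

lemma kilbas_saigo_0: "kilbas_saigo a m l 0 = 1"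
  unfolding kilbas_saigo_def by (simp add: powser_zero kilbas_saigo_coeff_def)

text \<open>Put x = (n + 1) * \<beta>. The Beta value contributes
  \<open>Gamma x * Gamma (1 - \<alpha>) / Gamma (x + (1 - \<alpha>))\<close>, the coefficient
  recursion \<open>Gamma (x + (1 - \<alpha>)) / Gamma (1 + x)\<close>, and
  \<open>Gamma (1 + x) = x * Gamma x\<close> absorbs the factor x that comes from differentiating
  the power.\<close>

lemma kilbas_saigo_coeff_Beta:
  fixes \<alpha> \<gamma> :: real
  assumes "0 < \<alpha>" "\<alpha> < 1" "0 \<le> \<gamma>"
  defines "c \<equiv> kilbas_saigo_coeff \<alpha> (1 + \<gamma> / \<alpha>) (\<gamma> / \<alpha>)"
    and "\<beta> \<equiv> \<alpha> + \<gamma>"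
  shows "real (Suc n) * \<beta> * c (Suc n) * Beta (real (Suc n) * \<beta>) (1 - \<alpha>) = Gamma (1 - \<alpha>) * c n"
proof -
  define x where "x = real (Suc n) * \<beta>"
  define y where "y = x + (1 - \<alpha>)"
  have "x > 0"
    unfolding x_def \<beta>_def using assms by (intro mult_pos_pos add_pos_nonneg) auto
  then have x: "x > 0" "y > 0"
    using assms by (auto simp: y_def)
  \<comment> \<open>For these parameters the Gamma arguments in the recursion become y and 1 +
    x.\<close>
  have "\<alpha> * (real n * (1 + \<gamma> / \<alpha>) + \<gamma> / \<alpha>) = y - 1"
    using assms by (simp add: x_def y_def field_simps)
  moreover have "\<alpha> * (real n * (1 + \<gamma> / \<alpha>) + \<gamma> / \<alpha> + 1) = x"
    using assms by (simp add: x_def field_simps)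
  ultimately have "c (Suc n) = c n * (Gamma y / Gamma (1 + x))"
    unfolding c_def kilbas_saigo_coeff_Suc by simp
  moreover have "Gamma (1 + x) = x * Gamma x"
    using x Gamma_plus1[of x] nonpos_Ints_nonpos[of x] by (auto simp: add.commute)
  moreover have "Gamma x \<noteq> 0" "Gamma y \<noteq> 0"
    using x by (auto dest: Gamma_real_pos)
  ultimately show ?thesis
    using x unfolding Beta_def x_def[symmetric] y_def[symmetric] by (simp add: field_simps)
qed

text \<open>The sign makes the norm of a term at z equal to the term of the real series at
  \<open>norm z\<close>, so absolute convergence is convergence of that real series.\<close>

lemma kilbas_saigo_coeff_nonneg:
  assumes "0 < a" "0 \<le> m" "0 \<le> l"
  shows "0 \<le> kilbas_saigo_coeff a m l n"
  unfolding kilbas_saigo_coeff_def using assms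
  by (intro prod_nonneg ballI divide_nonneg_nonneg Gamma_real_nonneg) (auto intro!: add_pos_nonneg)

section \<open>Termwise action of the operator, and nontriviality\<close>

theorem mainTheorem3:
  fixes \<alpha> \<gamma> :: real
    and \<kappa> :: "'a :: {real_normed_field, banach, second_countable_topology}"
  assumes "0 < \<alpha>" and "\<alpha> < 1" and "0 \<le> \<gamma>"
  shows "stretched_caputo_eigenfunction \<alpha> \<gamma> (- \<kappa>)
    (\<lambda>t. kilbas_saigo \<alpha> (1 + \<gamma> / \<alpha>) (\<gamma> / \<alpha>) (- \<kappa> * of_real (t powr (\<alpha> + \<gamma>))))"
proof -
  define \<beta> where "\<beta> = \<alpha> + \<gamma>"
  define m where "m = 1 + \<gamma> / \<alpha>"
  define l where "l = \<gamma> / \<alpha>"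
  define c where "c = kilbas_saigo_coeff \<alpha> m l"
  define f :: "real \<Rightarrow> 'a" where "f t = kilbas_saigo \<alpha> m l (- \<kappa> * of_real (t powr \<beta>))" for t
  \<comment> \<open>\<open>G n\<close> is the coefficient of
    \<open>s powr (real (Suc n) * \<beta> - 1)\<close> in the derivative of \<open>f\<close>; the
    constant term vanishes on differentiation, hence the index \<open>Suc n\<close>.\<close>
  define G :: "nat \<Rightarrow> 'a" where
    "G n = of_real (real (Suc n) * \<beta> * c (Suc n)) * (- \<kappa>) ^ Suc n" for n
  have \<beta>: "\<beta> > 0" and m: "m > 0" and l: "l \<ge> 0"
    using assms by (auto simp: \<beta>_def m_def l_def intro: add_pos_nonneg)
  note am = assms(1,2) m
  have c0: "c n \<ge> 0" for n
    unfolding c_def using assms m l by (intro kilbas_saigo_coeff_nonneg) auto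

  \<comment> \<open>Chain rule, away from s = 0, where the power need not be differentiable.
    Absolute summability is recorded for the later interchange of sum and integral.\<close>
  have df: "(f has_vector_derivative (\<Sum>n. G n * of_real (s powr (real (Suc n) * \<beta> - 1)))) (at s)"
    and dsum: "summable (\<lambda>n. norm (G n * of_real (s powr (real (Suc n) * \<beta> - 1))))"
    if s: "s > 0" for s
  proof -
    define z where "z = - \<kappa> * of_real (s powr \<beta>)"
    define d where "d = of_real (\<beta> * s powr (\<beta> - 1)) * - \<kappa>"
    define D where "D n = diffs (\<lambda>n. of_real (c n)) n * z ^ n" for n
    have pw: "s powr (\<beta> - 1) * (s powr \<beta>) ^ n = s powr (real (Suc n) * \<beta> - 1)" for n
    proof -
      have "(s powr \<beta>) ^ n = s powr (real n * \<beta>)"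
        using s by (simp add: powr_power mult.commute)
      then show ?thesis
        by (simp add: algebra_simps flip: powr_add)
    qed
    have eq: "d * D n = G n * of_real (s powr (real (Suc n) * \<beta> - 1))" for n
      unfolding pw[symmetric] d_def D_def G_def z_def diffs_def
      unfolding power_mult_distrib by (simp add: mult_ac del: of_nat_Suc)
    have D: "summable D"
      unfolding D_def c_def by (rule summable_diffs_kilbas_saigo[OF am])
    have "((\<lambda>s. - \<kappa> * of_real (s powr \<beta>)) has_vector_derivative d) (at s)"
      unfolding d_def using s
      by (auto intro!: derivative_eq_intros simp: has_real_derivative_iff_has_vector_derivative[symmetric] mult_ac)
    from field_vector_diff_chain_at[OF this kilbas_saigo_has_field_derivative[OF am, of l]]
    have "(f has_vector_derivative d * suminf D) (at s)"
      unfolding f_def o_def D_def c_def z_def .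
    then show "(f has_vector_derivative (\<Sum>n. G n * of_real (s powr (real (Suc n) * \<beta> - 1)))) (at s)"
      using suminf_mult[OF D, of d] by (simp only: eq)
    \<comment> \<open>Absolute convergence reduces to the real derived series at
      \<open>norm z\<close>, whose terms are nonnegative.\<close>
    have nD: "norm (D n) = norm (diffs (\<lambda>n. of_real (c n)) n * (of_real (norm z) :: real) ^ n)" for n
      using c0 by (simp add: D_def diffs_def norm_mult norm_power del: of_nat_Suc)
    have "summable (\<lambda>n. norm (D n))"
      unfolding nD using c0 summable_diffs_kilbas_saigo[OF am, of l "norm z"]
      by (simp add: diffs_def c_def)
    then have "summable (\<lambda>n. norm d * norm (D n))"
      by (rule summable_mult)
    then show "summable (\<lambda>n. norm (G n * of_real (s powr (real (Suc n) * \<beta> - 1))))"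
      by (simp only: eq flip: norm_mult)
  qed

  have main: "stretched_caputo_defined \<alpha> f t \<and> stretched_caputo \<alpha> \<gamma> f t = - \<kappa> * f t"
    if t: "t > 0" for t
  proof -
    \<comment> \<open>\<open>b n\<close> is a power times the Caputo kernel, cut off outside the
      interval, with exponents in Beta form; \<open>v n\<close> is its integral and \<open>K\<close>
      the reciprocal of the prefactor of the operator.\<close>
    define b where "b n s = indicator {0<..<t} s *\<^sub>R
      (s powr (real (Suc n) * \<beta> - 1) * (t - s) powr ((1 - \<alpha>) - 1))" for n s
    define K where "K = Gamma (1 - \<alpha>) * t powr \<gamma>"
    define v where "v n = t powr (real (Suc n) * \<beta> - \<alpha>) * Beta (real (Suc n) * \<beta>) (1 - \<alpha>)" for n
    have b: "has_bochner_integral lborel (b n) (v n)" for n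
    proof -
      have "real (Suc n) * \<beta> > 0"
        using \<beta> by simp
      then show ?thesis
        using has_bochner_integral_Beta_scaled[of "real (Suc n) * \<beta>" "1 - \<alpha>" t] assms t
        unfolding b_def v_def by simp
    qed
    have K: "K \<ge> 0"
      using assms unfolding K_def by (intro mult_nonneg_nonneg Gamma_real_nonneg) auto
    \<comment> \<open>Since \<beta> - \<alpha> = \<gamma>, the exponent (n + 1) * \<beta> - \<alpha>
      is \<gamma> + n * \<beta>: the power t^\<gamma> goes into \<open>K\<close>, and the n-th power
      of the series remains.\<close>
    have cv: "real (Suc n) * \<beta> * c (Suc n) * v n = K * (c n * (t powr \<beta>) ^ n)" for n
    proof -
      have "t powr (real (Suc n) * \<beta> - \<alpha>) = t powr \<gamma> * (t powr \<beta>) ^ n"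
        using t by (simp add: powr_power \<beta>_def algebra_simps flip: powr_add)
      moreover have "real (Suc n) * \<beta> * c (Suc n) * Beta (real (Suc n) * \<beta>) (1 - \<alpha>) = Gamma (1 - \<alpha>) * c n"
        using kilbas_saigo_coeff_Beta[OF assms, of n] unfolding c_def m_def l_def \<beta>_def .
      ultimately show ?thesis
        unfolding v_def K_def by (simp only: mult_ac)
    qed
    \<comment> \<open>The shift from \<open>Suc n\<close> to n leaves over one factor -\<kappa>, the
      eigenvalue.\<close>
    have Gv: "G n * of_real (v n) =
        (of_real K * - \<kappa>) * (of_real (c n) * (- \<kappa> * of_real (t powr \<beta>)) ^ n)" for n
    proof -
      have "G n * of_real (v n) = of_real (real (Suc n) * \<beta> * c (Suc n) * v n) * (- \<kappa>) ^ Suc n"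
        unfolding G_def by simp
      also have "\<dots> = of_real (K * (c n * (t powr \<beta>) ^ n)) * (- \<kappa>) ^ Suc n"
        unfolding cv ..
      also have "\<dots> = (of_real K * - \<kappa>) * (of_real (c n) * (- \<kappa> * of_real (t powr \<beta>)) ^ n)"
        unfolding power_mult_distrib by simp
      finally show ?thesis .
    qed
    have hi: "has_bochner_integral lborel (\<lambda>s. G n * of_real (b n s)) (G n * of_real (v n))" for n
      by (intro has_bochner_integral_mult_right has_bochner_integral_of_real b)
    have b0: "b n s \<ge> 0" for n s
      unfolding b_def by simp
    have "has_bochner_integral lborel (\<lambda>s. norm (G n) * b n s) (norm (G n) * v n)" for n
      by (intro has_bochner_integral_mult_right b)
    then have hin: "(\<integral>s. norm (G n * of_real (b n s)) \<partial>lborel) = norm (G n) * v n" for n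
      using b0 by (simp add: norm_mult has_bochner_integral_iff)
    have v0: "v n \<ge> 0" for n
      using b[of n] b0 Bochner_Integration.integral_nonneg[of lborel "b n"] by (simp add: has_bochner_integral_iff)
    \<comment> \<open>As \<open>b n\<close> is nonnegative, taking norms only affects
      \<open>G n\<close>; up to a constant factor the terms are those of the real series at the norm
      of the argument.\<close>
    have sumn: "summable (\<lambda>n. \<integral>s. norm (G n * of_real (b n s)) \<partial>lborel)"
    proof -
      have "norm (G n) * v n = (K * norm \<kappa>) * (c n * norm (\<kappa> * of_real (t powr \<beta>)) ^ n)" for n
      proof -
        have "norm (G n) * v n = norm (G n * of_real (v n))"
          using v0 by (simp add: norm_mult)
        also have "\<dots> = (K * norm \<kappa>) * (c n * norm (\<kappa> * of_real (t powr \<beta>)) ^ n)"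
          unfolding Gv using K c0 by (simp add: norm_mult norm_power)
        finally show ?thesis .
      qed
      moreover have "summable (\<lambda>n. c n * norm (\<kappa> * of_real (t powr \<beta>)) ^ n)"
        using summable_kilbas_saigo[OF am, of l "norm (\<kappa> * of_real (t powr \<beta>))"]
        unfolding c_def by simp
      ultimately show ?thesis
        unfolding hin by (simp add: summable_mult)
    qed
    \<comment> \<open>The cut-off kernel is a scalar independent of n, so it can be pulled out of
      the series for the derivative.\<close>
    have Gb: "G n * of_real (b n s) = (indicator {0<..<t} s / (t - s) powr \<alpha>) *\<^sub>R
        (G n * of_real (s powr (real (Suc n) * \<beta> - 1)))" for n s
      unfolding b_def by (simp add: scaleR_conv_of_real powr_minus divide_inverse mult_ac)
    have sm: "summable (\<lambda>n. norm (G n * of_real (b n s)))" for s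
    proof (cases "s \<in> {0<..<t}")
      case True
      then show ?thesis
        unfolding Gb norm_scaleR by (intro summable_mult dsum) simp
    qed (simp add: Gb)
    \<comment> \<open>Valid for every real s, both sides being 0 off the interval; it can thus be
      rewritten inside the integral and inside the integrability claim.\<close>
    have Ieq: "indicator {0<..<t} s *\<^sub>R stretched_caputo_integrand \<alpha> f t s
        = (\<Sum>n. G n * of_real (b n s))" for s
    proof (cases "s \<in> {0<..<t}")
      case True
      have "summable (\<lambda>n. G n * of_real (s powr (real (Suc n) * \<beta> - 1)))"
        by (rule summable_norm_cancel, rule dsum) (use True in simp)
      from suminf_scaleR_right[OF this, of "indicator {0<..<t} s / (t - s) powr \<alpha>"]
      show ?thesis
        using True vector_derivative_at[OF df, of s]
        unfolding Gb stretched_caputo_integrand_def by (simp add: divide_inverse)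
    qed (simp add: Gb)
    have ints: "integrable lborel (\<lambda>s. G n * of_real (b n s))" for n
      using hi by (simp add: has_bochner_integral_iff)
    \<comment> \<open>\<open>I\<close> makes the operator meaningful at t; \<open>S\<close> gives
      its value termwise.\<close>
    have I: "integrable lborel (\<lambda>s. \<Sum>n. G n * of_real (b n s))"
      and S: "(\<lambda>n. \<integral>s. G n * of_real (b n s) \<partial>lborel) sums
               (\<integral>s. (\<Sum>n. G n * of_real (b n s)) \<partial>lborel)"
      by (rule integrable_suminf[OF ints AE_I2[OF sm] sumn], rule sums_integral[OF ints AE_I2[OF sm] sumn])
    have "(\<lambda>n. (of_real K * - \<kappa>) * (of_real (c n) * (- \<kappa> * of_real (t powr \<beta>)) ^ n)) sums
        ((of_real K * - \<kappa>) * f t)"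
      unfolding f_def kilbas_saigo_def c_def
      by (intro sums_mult summable_sums summable_kilbas_saigo[OF am])
    moreover have "(\<integral>s. G n * of_real (b n s) \<partial>lborel) =
        (of_real K * - \<kappa>) * (of_real (c n) * (- \<kappa> * of_real (t powr \<beta>)) ^ n)" for n
      using hi[of n] unfolding Gv by (simp add: has_bochner_integral_iff)
    ultimately have val: "(LINT s:{0<..<t}|lborel. stretched_caputo_integrand \<alpha> f t s) =
        (of_real K * - \<kappa>) * f t"
      using S unfolding set_lebesgue_integral_def Ieq by (simp only: sums_unique2)
    have one: "t powr (- \<gamma>) / Gamma (1 - \<alpha>) * K = 1"
    proof -
      have "Gamma (1 - \<alpha>) > 0"
        using assms by (intro Gamma_real_pos) auto
      then show ?thesis
        using t by (simp add: K_def powr_minus)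
    qed
    have "stretched_caputo \<alpha> \<gamma> f t =
        of_real (t powr (- \<gamma>) / Gamma (1 - \<alpha>) * K) * (- \<kappa> * f t)"
      unfolding stretched_caputo_def val scaleR_conv_of_real of_real_mult by (simp only: mult.assoc)
    then have "stretched_caputo \<alpha> \<gamma> f t = - \<kappa> * f t"
      unfolding one by simp
    moreover have "stretched_caputo_defined \<alpha> f t"
      unfolding stretched_caputo_defined_def set_integrable_def Ieq
      using I by (auto intro: differentiableI_vector[OF df])
    ultimately show ?thesis by blast
  qed

  \<comment> \<open>As t tends to 0 from the right, the argument of the series tends to 0 because
    \<beta> > 0; by continuity \<open>f\<close> tends to 1 and is nonzero for small t.\<close>
  have "\<exists>t>0. f t \<noteq> 0"
  proof -
    have "isCont (kilbas_saigo \<alpha> m l) (0 :: 'a)"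
      by (rule DERIV_isCont[OF kilbas_saigo_has_field_derivative[OF am]])
    moreover have "((\<lambda>t. - \<kappa> * of_real (t powr \<beta>)) \<longlongrightarrow> - \<kappa> * of_real 0) (at_right 0)"
      using \<beta> by (intro tendsto_intros) real_asymp
    ultimately have "(f \<longlongrightarrow> kilbas_saigo \<alpha> m l 0) (at_right 0)"
      unfolding f_def using isCont_tendsto_compose[of 0 "kilbas_saigo \<alpha> m l"] by simp
    then have "\<forall>\<^sub>F t in at_right 0. f t \<noteq> 0"
      by (rule tendsto_imp_eventually_ne) (simp add: kilbas_saigo_0)
    then have "\<forall>\<^sub>F t in at_right 0. t > 0 \<and> f t \<noteq> 0"
      using eventually_at_right_less[of "0 :: real"] by eventually_elim simp
    then show ?thesis
      using eventually_happens' trivial_limit_at_right_real by blast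
  qed
  with main show ?thesis
    unfolding stretched_caputo_eigenfunction_def f_def m_def l_def \<beta>_def by blast
qed

end
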